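(* There exists a pair of nonisomorphic $\mathbb{Z}^2$-odometers, one of which is a speedup of the other.
   Context: A $\mathbb{Z}^d$-action $\mathbf{T}:\mathbb{Z}^d\curvearrowright X$ on a topological space $X$ assigns to each $\mathbf{v}\in\mathbb{Z}^d$ a homeomorphism $\mathbf{T}^{\mathbf{v}}:X\to X$ with $\mathbf{T}^{\mathbf{v}+\mathbf{w}}=\mathbf{T}^{\mathbf{v}}\circ\mathbf{T}^{\mathbf{w}}$ and $\mathbf{T}^{\mathbf{0}}=\mathrm{id}$. Actions $\mathbf{T}:\mathbb{Z}^d\curvearrowright X$ and $\mathbf{S}:\mathbb{Z}^d\curvearrowright Y$ are conjugate if there is a homeomorphism $\Phi:X\to Y$ with $\Phi\circ\mathbf{T}^{\mathbf{v}}=\mathbf{S}^{\mathbf{v}}\circ\Phi$ for all $\mathbf{v}$; they are isomorphic if there are a homeomorphism $\Phi:X\to Y$ and a group isomorphism $\vartheta:\mathbb{Z}^d\to\mathbb{Z}^d$ with $\Phi\circ\mathbf{T}^{\mathbf{v}}=\mathbf{S}^{\vartheta(\mathbf{v})}\circ\Phi$ for all $\mathbf{v}$. A cocycle for $\mathbf{T}:\mathbb{Z}^{d_1}\curvearrowright X$ is a function $\mathbf{p}:X\times\mathbb{Z}^{d_2}\to\mathbb{Z}^{d_1}$ with $\mathbf{p}(x,\mathbf{0})=\mathbf{0}$ and $\mathbf{p}(x,\mathbf{v})+\mathbf{p}(\mathbf{T}^{\mathbf{p}(x,\mathbf{v})}(x),\mathbf{w})=\mathbf{p}(x,\mathbf{v}+\mathbf{w})$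 for all $x\in X$ and $\mathbf{v},\mathbf{w}\in\mathbb{Z}^{d_2}$. A speedup of $(X,\mathbf{T})$ is an action (by homeomorphisms) $\mathbf{S}:\mathbb{Z}^{d_2}\curvearrowright X$ with $\mathbf{S}^{\mathbf{v}}(x)=\mathbf{T}^{\mathbf{p}(x,\mathbf{v})}(x)$ for some cocycle $\mathbf{p}$ for $\mathbf{T}$. Let $\mathfrak{G}=\{G_j\}_{j\ge1}$ be a decreasing sequence of finite-index subgroups of $\mathbb{Z}^d$, and let $X_{\mathfrak{G}}=\varprojlim\mathbb{Z}^d/G_j$ be the inverse limit along the quotient maps $\mathbb{Z}^d/G_{j+1}\to\mathbb{Z}^d/G_j$ (topologized as a subspace of the product of discrete spaces), with the action $\sigma_{\mathfrak{G}}^{\mathbf{v}}(\mathbf{x}_1,\mathbf{x}_2,\dots)=(\mathbf{x}_1+\mathbf{v},\mathbf{x}_2+\mathbf{v},\dots)$, the $j$-th coordinate taken mod $G_j$. A $\mathbb{Z}^d$-odometer is any $\mathbb{Z}^d$-action conjugate to some such $(X_{\mathfrak{G}},\sigma_{\mathfrak{G}})$. Odometers are regarded as minimal Cantor systems, i.e. $G_j\ne G_{j+1}$ for infinitely many $j$. *)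

theory Defs
  imports "HOL-Analysis.Analysis" "HOL-Algebra.Coset"
begin

definition zd_group :: "(int ^ 'd::finite) monoid"
  where "zd_group = \<lparr>carrier = UNIV, monoid.mult = (+), one = 0\<rparr>"

lemma group_zd_group: "group (zd_group :: (int ^ 'd::finite) monoid)"
  unfolding zd_group_def by (rule groupI) (auto simp: add.assoc intro: exI[of _ "- x" for x])

text \<open>All conditions on actions, conjugacies and cocycles are relativised to \<open>topspace X\<close>;
  values outside the space are irrelevant.\<close>

definition zd_action :: "'a topology \<Rightarrow> (int ^ 'd::finite \<Rightarrow> 'a \<Rightarrow> 'a) \<Rightarrow> bool"
  where "zd_action X T \<longleftrightarrow>
    (\<forall>v. homeomorphic_map X X (T v)) \<and>
    (\<forall>v w. \<forall>x\<in>topspace X. T (v + w) x = T v (T w x)) \<and>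
    (\<forall>x\<in>topspace X. T 0 x = x)"

definition conjugate_actions ::
    "'a topology \<Rightarrow> (int ^ 'd::finite \<Rightarrow> 'a \<Rightarrow> 'a) \<Rightarrow> 'b topology \<Rightarrow> (int ^ 'd \<Rightarrow> 'b \<Rightarrow> 'b) \<Rightarrow> bool"
  where "conjugate_actions X T Y S \<longleftrightarrow>
    (\<exists>\<Phi>. homeomorphic_map X Y \<Phi> \<and>
      (\<forall>v. \<forall>x\<in>topspace X. \<Phi> (T v x) = S v (\<Phi> x)))"

definition isomorphic_actions ::
    "'a topology \<Rightarrow> (int ^ 'd::finite \<Rightarrow> 'a \<Rightarrow> 'a) \<Rightarrow> 'b topology \<Rightarrow> (int ^ 'd \<Rightarrow> 'b \<Rightarrow> 'b) \<Rightarrow> bool"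
  where "isomorphic_actions X T Y S \<longleftrightarrow>
    (\<exists>\<Phi> \<theta>. homeomorphic_map X Y \<Phi> \<and> \<theta> \<in> iso zd_group zd_group \<and>
      (\<forall>v. \<forall>x\<in>topspace X. \<Phi> (T v x) = S (\<theta> v) (\<Phi> x)))"

text \<open>No continuity is imposed on the cocycle.\<close>

definition cocycle ::
    "'a topology \<Rightarrow> (int ^ 'd1::finite \<Rightarrow> 'a \<Rightarrow> 'a) \<Rightarrow> ('a \<Rightarrow> int ^ 'd2::finite \<Rightarrow> int ^ 'd1) \<Rightarrow> bool"
  where "cocycle X T p \<longleftrightarrow>
    (\<forall>x\<in>topspace X. p x 0 = 0 \<and>
      (\<forall>v w. p x v + p (T (p x v) x) w = p x (v + w)))"

text \<open>\<open>is_speedup X T S\<close>: the action \<open>S\<close> is a speedup of the action \<open>T\<close>.\<close>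

definition is_speedup ::
    "'a topology \<Rightarrow> (int ^ 'd1::finite \<Rightarrow> 'a \<Rightarrow> 'a) \<Rightarrow> (int ^ 'd2::finite \<Rightarrow> 'a \<Rightarrow> 'a) \<Rightarrow> bool"
  where "is_speedup X T S \<longleftrightarrow> zd_action X T \<and> zd_action X S \<and>
    (\<exists>p. cocycle X T p \<and> (\<forall>v. \<forall>x\<in>topspace X. S v x = T (p x v) x))"

text \<open>The last conjunct makes the inverse limit infinite, hence a Cantor space.\<close>

definition odometer_sequence :: "(nat \<Rightarrow> (int ^ 'd::finite) set) \<Rightarrow> bool"
  where "odometer_sequence G \<longleftrightarrow>
    (\<forall>j. subgroup (G j) zd_group \<and> finite (rcosets\<^bsub>zd_group\<^esub> (G j))) \<and>
    (\<forall>j. G (Suc j) \<subseteq> G j) \<and>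
    (\<exists>\<^sub>\<infinity>j. G j \<noteq> G (Suc j))"

text \<open>The quotient map from \<open>\<int>\<^sup>d / G (Suc j)\<close> to \<open>\<int>\<^sup>d / G j\<close> sends a coset \<open>C\<close> to the coset
  \<open>G j + C\<close>.\<close>

definition odometer_set :: "(nat \<Rightarrow> (int ^ 'd::finite) set) \<Rightarrow> (nat \<Rightarrow> (int ^ 'd) set) set"
  where "odometer_set G =
    {x. (\<forall>j. x j \<in> carrier (zd_group Mod G j)) \<and>
        (\<forall>j. x j = G j <#>\<^bsub>zd_group\<^esub> x (Suc j))}"

definition odometer_space :: "(nat \<Rightarrow> (int ^ 'd::finite) set) \<Rightarrow> (nat \<Rightarrow> (int ^ 'd) set) topology"
  where "odometer_space G =
    subtopology
      (product_topology (\<lambda>j. discrete_topology (carrier (zd_group Mod G j))) UNIV)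
      (odometer_set G)"

definition odometer_shift ::
    "(nat \<Rightarrow> (int ^ 'd::finite) set) \<Rightarrow> int ^ 'd \<Rightarrow> (nat \<Rightarrow> (int ^ 'd) set) \<Rightarrow> (nat \<Rightarrow> (int ^ 'd) set)"
  where "odometer_shift G v x =
    (\<lambda>j. x j \<otimes>\<^bsub>zd_group Mod G j\<^esub> (G j #>\<^bsub>zd_group\<^esub> v))"

definition is_odometer :: "'a topology \<Rightarrow> (int ^ 'd::finite \<Rightarrow> 'a \<Rightarrow> 'a) \<Rightarrow> bool"
  where "is_odometer X T \<longleftrightarrow> zd_action X T \<and>
    (\<exists>G. odometer_sequence G \<and> conjugate_actions X T (odometer_space G) (odometer_shift G))"

end

theory Submission imports Defs begin

text \<open>
  Write \<open>Q j = 2 \<sqdot> 3^j \<int> \<times> 2 \<sqdot> 3^j \<int>\<close> and \<open>R j = 4 \<sqdot> 3^j \<int> \<times> 3^j \<int>\<close>. The two odometers are those of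
  the sequences \<open>Q\<close> and \<open>R\<close>. Restricted to the index-4 subgroups \<open>Q 0\<close> and \<open>R 0\<close>, each of them
  splits into four copies of the same system, the 3-adic odometer on pairs; they differ only in how
  the four copies are glued, along \<open>\<int>/2 \<times> \<int>/2\<close> for \<open>Q\<close> and along \<open>\<int>/4\<close> for \<open>R\<close>. Speedups
  do not see this difference, isomorphisms do.

  Speedup: a bijection of \<open>\<int>\<^sup>2\<close>, \<open>regroup\<close>, moves the lowest binary digit of the second coordinate
  into the first coordinate. It turns \<open>Q 0\<close>-translations into \<open>R 0\<close>-translations and matches the
  cosets of \<open>Q j\<close> with those of \<open>R j\<close> at every level \<open>j\<close> (\<open>coset_equivalence_regroup\<close>), so it
  extends to a homeomorphism of the two inverse limits. Pull the \<open>R\<close>-odometer back along it. To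
  move a point by \<open>v\<close> in the pulled-back action is to move an integer point \<open>u\<close> to
  \<open>regroup\<^sup>-\<^sup>1 (regroup u + v)\<close>, and the displacement from \<open>u\<close> depends only on \<open>v\<close> and on the
  class of \<open>u\<close> modulo \<open>Q 0\<close> (\<open>regroup_displacement_cong\<close>). Hence on each of the four clopen cosets
  of level \<open>0\<close> the pulled-back action of \<open>v\<close> is one shift of the \<open>Q\<close>-odometer, and the displacement
  is the cocycle (\<open>is_speedup_transported_shift\<close>).

  Nonisomorphism: by continuity, an isomorphism with group automorphism \<open>\<theta>\<close> forces
  \<open>\<theta> ` Q j \<subseteq> R 0\<close> for some \<open>j\<close> (\<open>isomorphic_odometers_absorb\<close>). Then \<open>2 \<sqdot> 3^j\<close> annihilates
  \<open>\<int>\<^sup>2 / R 0\<close>, which is cyclic of order 4; this is impossible.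
\<close>

section \<open>Cosets in \<open>\<int>\<^sup>d\<close>\<close>

lemma subgroup_zd_group_iff:
  "subgroup K (zd_group :: (int ^ 'd::finite) monoid) \<longleftrightarrow> 0 \<in> K \<and> (\<forall>u\<in>K. \<forall>w\<in>K. u - w \<in> K)"
proof
  assume K: "subgroup K (zd_group :: (int ^ 'd) monoid)"
  have inv: "inv\<^bsub>zd_group\<^esub> w = - w" for w :: "int ^ 'd"
    by (rule group.inv_equality[OF group_zd_group]) (auto simp: zd_group_def)
  show "0 \<in> K \<and> (\<forall>u\<in>K. \<forall>w\<in>K. u - w \<in> K)"
    using subgroup.one_closed[OF K] subgroup.m_closed[OF K] subgroup.m_inv_closed[OF K]
    unfolding inv by (auto simp: zd_group_def) (metis diff_conv_add_uminus)
next
  assume K: "0 \<in> K \<and> (\<forall>u\<in>K. \<forall>w\<in>K. u - w \<in> K)"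
  have inv: "inv\<^bsub>zd_group\<^esub> w = - w" for w :: "int ^ 'd"
    by (rule group.inv_equality[OF group_zd_group]) (auto simp: zd_group_def)
  have neg: "- w \<in> K" if "w \<in> K" for w
    using K that by (metis diff_0)
  have add: "u + w \<in> K" if "u \<in> K" "w \<in> K" for u w
    using K that(1) neg[OF that(2)] by (metis diff_minus_eq_add)
  show "subgroup K (zd_group :: (int ^ 'd) monoid)"
    by (rule group.subgroupI[OF group_zd_group])
      (use K neg add inv in \<open>auto simp: zd_group_def\<close>)
qed

definition zd_coset :: "(int ^ 'd::finite) set \<Rightarrow> int ^ 'd \<Rightarrow> (int ^ 'd) set"
  where "zd_coset K u = {w. w - u \<in> K}"

lemma r_coset_zd_group: "K #>\<^bsub>zd_group\<^esub> u = zd_coset K u"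
  by (force simp: zd_coset_def r_coset_def zd_group_def)

lemma carrier_zd_group_Mod: "carrier (zd_group Mod K) = range (zd_coset K)"
  by (auto simp: FactGroup_def RCOSETS_def r_coset_zd_group) (auto simp: zd_group_def)

lemma set_mult_zd_group: "A <#>\<^bsub>zd_group\<^esub> B = (\<Union>a\<in>A. (+) a ` B)"
  by (auto simp: set_mult_def zd_group_def)

context
  fixes K :: "(int ^ 'd::finite) set"
  assumes K: "subgroup K zd_group"
begin

lemma zd_zero: "0 \<in> K"
  and zd_diff: "u \<in> K \<Longrightarrow> w \<in> K \<Longrightarrow> u - w \<in> K"
  using K by (auto simp: subgroup_zd_group_iff)

lemma zd_uminus: "u \<in> K \<Longrightarrow> - u \<in> K"
  using zd_diff[OF zd_zero] by simp

lemma zd_add: "u \<in> K \<Longrightarrow> w \<in> K \<Longrightarrow> u + w \<in> K"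
  using zd_diff[of u "- w"] zd_uminus by simp

lemma zd_diff_commute: "u - w \<in> K \<longleftrightarrow> w - u \<in> K"
  using zd_uminus[of "u - w"] zd_uminus[of "w - u"] by auto

lemma zd_coset_self: "u \<in> zd_coset K u"
  by (simp add: zd_coset_def zd_zero)

lemma zd_coset_eqI:
  assumes "w \<in> zd_coset K u"
  shows "zd_coset K u = zd_coset K w"
proof -
  have wu: "w - u \<in> K" "u - w \<in> K"
    using assms zd_diff_commute by (auto simp: zd_coset_def)
  have "x - u \<in> K \<longleftrightarrow> x - w \<in> K" for x
    using zd_add[OF _ wu(1), of "x - w"] zd_add[OF _ wu(2), of "x - u"] by auto
  then show ?thesis by (simp add: zd_coset_def)
qed

lemma zd_coset_translate: "(\<lambda>w. w + v) ` zd_coset K u = zd_coset K (u + v)"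
proof (intro Set.set_eqI iffI)
  fix w assume "w \<in> zd_coset K (u + v)"
  then show "w \<in> (\<lambda>w. w + v) ` zd_coset K u"
    by (intro image_eqI[of _ _ "w - v"]) (auto simp: zd_coset_def algebra_simps)
qed (auto simp: zd_coset_def)

lemma Mod_mult_r_coset:
  assumes "C \<in> range (zd_coset K)"
  shows "C \<otimes>\<^bsub>zd_group Mod K\<^esub> (K #>\<^bsub>zd_group\<^esub> v) = (\<lambda>w. w + v) ` C"
proof -
  obtain u where C: "C = zd_coset K u" using assms by auto
  have "C <#>\<^bsub>zd_group\<^esub> zd_coset K v = zd_coset K (u + v)"
  proof (intro Set.set_eqI iffI)
    fix w assume "w \<in> C <#>\<^bsub>zd_group\<^esub> zd_coset K v"
    then obtain a b where "w = a + b" "a - u \<in> K" "b - v \<in> K"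
      by (auto simp: set_mult_zd_group C zd_coset_def)
    then show "w \<in> zd_coset K (u + v)"
      using zd_add[of "a - u" "b - v"] by (simp add: zd_coset_def algebra_simps)
  next
    fix w assume "w \<in> zd_coset K (u + v)"
    then have "w = u + (w - u)" "w - u \<in> zd_coset K v"
      by (auto simp: zd_coset_def algebra_simps)
    then show "w \<in> C <#>\<^bsub>zd_group\<^esub> zd_coset K v"
      using zd_coset_self[of u] unfolding set_mult_zd_group C by blast
  qed
  then show ?thesis
    by (simp add: FactGroup_def r_coset_zd_group C zd_coset_translate)
qed

text \<open>For a set \<open>D\<close> that lies in a single coset of \<open>K\<close>, such as a coset of a smaller subgroup, the
  inverse-limit condition on consecutive coordinates is plain inclusion. Points of an odometer can
  thus be handled as decreasing chains of cosets, without any quotient group.\<close>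

lemma coset_eq_set_mult_iff:
  assumes "C \<in> range (zd_coset K)" "D \<noteq> {}" "\<And>u w. u \<in> D \<Longrightarrow> w \<in> D \<Longrightarrow> u - w \<in> K"
  shows "C = K <#>\<^bsub>zd_group\<^esub> D \<longleftrightarrow> D \<subseteq> C"
proof -
  obtain d where d: "d \<in> D" using assms(2) by auto
  have KD: "K <#>\<^bsub>zd_group\<^esub> D = zd_coset K d"
  proof (intro Set.set_eqI iffI)
    fix w assume "w \<in> K <#>\<^bsub>zd_group\<^esub> D"
    then obtain k e where "w = k + e" "k \<in> K" "e \<in> D" by (auto simp: set_mult_zd_group)
    then show "w \<in> zd_coset K d"
      using zd_add[OF _ assms(3)[OF _ d]] by (simp add: zd_coset_def add_diff_eq)
  next
    fix w assume "w \<in> zd_coset K d"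
    then have "w = (w - d) + d" "w - d \<in> K" by (auto simp: zd_coset_def)
    then show "w \<in> K <#>\<^bsub>zd_group\<^esub> D"
      using d unfolding set_mult_zd_group by blast
  qed
  have "D \<subseteq> zd_coset K d"
    using assms(3) d by (auto simp: zd_coset_def)
  moreover have "C = zd_coset K d" if "d \<in> C"
    using assms(1) that zd_coset_eqI by auto
  ultimately show ?thesis using KD d by blast
qed

end

section \<open>Odometers as spaces of decreasing chains of cosets\<close>

lemma odometer_sequenceD:
  assumes "odometer_sequence G"
  shows "subgroup (G j) zd_group" and "i \<le> j \<Longrightarrow> G j \<subseteq> G i"
  using assms lift_Suc_antimono_le[of G i j] by (auto simp: odometer_sequence_def)

lemma odometer_set_iff:
  assumes G: "odometer_sequence G"
  shows "x \<in> odometer_set G \<longleftrightarrow>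
    (\<forall>j. x j \<in> range (zd_coset (G j))) \<and> (\<forall>j. x (Suc j) \<subseteq> x j)"
proof -
  have level: "x j = G j <#>\<^bsub>zd_group\<^esub> x (Suc j) \<longleftrightarrow> x (Suc j) \<subseteq> x j"
    if x: "\<forall>j. x j \<in> range (zd_coset (G j))" for j
  proof (rule coset_eq_set_mult_iff[OF odometer_sequenceD(1)[OF G]])
    show "x j \<in> range (zd_coset (G j))" using x by blast
    obtain c where c: "x (Suc j) = zd_coset (G (Suc j)) c" using x by blast
    show "x (Suc j) \<noteq> {}"
      using zd_coset_self[OF odometer_sequenceD(1)[OF G]] c by blast
    fix u w assume "u \<in> x (Suc j)" "w \<in> x (Suc j)"
    then have "u - c \<in> G (Suc j)" "w - c \<in> G (Suc j)" by (auto simp: c zd_coset_def)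
    then have "(u - c) - (w - c) \<in> G (Suc j)"
      by (rule zd_diff[OF odometer_sequenceD(1)[OF G]])
    then show "u - w \<in> G j" using odometer_sequenceD(2)[OF G, of j "Suc j"] by auto
  qed
  show ?thesis
    unfolding odometer_set_def carrier_zd_group_Mod mem_Collect_eq
    by (intro conj_cong refl all_cong1) (rule level)
qed

lemma odometer_set_carrier: "x \<in> odometer_set G \<Longrightarrow> x j \<in> carrier (zd_group Mod G j)"
  unfolding odometer_set_def by blast

lemma topspace_odometer_space: "topspace (odometer_space G) = odometer_set G"
  using odometer_set_carrier by (auto simp: odometer_space_def)

lemma odometer_set_coset:
  assumes "odometer_sequence G" "x \<in> odometer_set G" "u \<in> x j"
  shows "x j = zd_coset (G j) u"
proof -
  obtain c where "x j = zd_coset (G j) c"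
    using assms(2) unfolding odometer_set_iff[OF assms(1)] by blast
  then show ?thesis
    using zd_coset_eqI[OF odometer_sequenceD(1)[OF assms(1)], of u j c] assms(3) by blast
qed

lemma odometer_set_nonempty:
  assumes "odometer_sequence G" "x \<in> odometer_set G"
  shows "x j \<noteq> {}"
proof -
  obtain c where "x j = zd_coset (G j) c"
    using assms(2) unfolding odometer_set_iff[OF assms(1)] by blast
  then show ?thesis
    using zd_coset_self[OF odometer_sequenceD(1)[OF assms(1)]] by blast
qed

lemma odometer_set_mono:
  assumes "odometer_sequence G" "x \<in> odometer_set G" "i \<le> j"
  shows "x j \<subseteq> x i"
  using assms(2,3) lift_Suc_antimono_le[of x i j] unfolding odometer_set_iff[OF assms(1)] by blast

text \<open>All maps below, the shifts included, act on a point by taking images of its cosets under a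
  map of integer vectors; composition and inversion then reduce to those of that map.\<close>

definition levelwise :: "('a \<Rightarrow> 'b) \<Rightarrow> (nat \<Rightarrow> 'a set) \<Rightarrow> nat \<Rightarrow> 'b set"
  where "levelwise f x = (\<lambda>j. f ` x j)"

lemma levelwise_compose: "levelwise f (levelwise g x) = levelwise (\<lambda>u. f (g u)) x"
  by (simp add: levelwise_def image_image)

lemma levelwise_inv:
  assumes "bij f"
  shows "levelwise (inv_into UNIV f) (levelwise f x) = x" "levelwise f (levelwise (inv_into UNIV f) y) = y"
  using assms by (simp_all add: levelwise_def image_image bij_is_surj surj_f_inv_f bij_is_inj)

lemma odometer_shift_eq_levelwise:
  assumes "odometer_sequence G" "x \<in> odometer_set G"
  shows "odometer_shift G v x = levelwise (\<lambda>u. u + v) x"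
proof -
  have "x j \<in> range (zd_coset (G j))" for j
    using assms(2) unfolding odometer_set_iff[OF assms(1)] by blast
  then show ?thesis
    unfolding odometer_shift_def levelwise_def
    by (intro ext Mod_mult_r_coset[OF odometer_sequenceD(1)[OF assms(1)]])
qed

section \<open>Homeomorphisms induced by coset-preserving bijections\<close>

text \<open>The bijection need not be a homomorphism: only the partitions into cosets are matched, not
  the group structure. This is what leaves room for nonisomorphic odometers.\<close>

definition coset_equivalence ::
    "(nat \<Rightarrow> (int ^ 'd::finite) set) \<Rightarrow> (nat \<Rightarrow> (int ^ 'e::finite) set) \<Rightarrow> (int ^ 'd \<Rightarrow> int ^ 'e) \<Rightarrow> bool"
  where "coset_equivalence G H f \<longleftrightarrow>
    bij f \<and> (\<forall>j u w. f u - f w \<in> H j \<longleftrightarrow> u - w \<in> G j)"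

lemma coset_equivalence_inv:
  assumes "coset_equivalence G H f"
  shows "coset_equivalence H G (inv_into UNIV f)"
proof -
  have f: "bij f" "\<And>j u w. f u - f w \<in> H j \<longleftrightarrow> u - w \<in> G j"
    using assms by (auto simp: coset_equivalence_def)
  show ?thesis
    using f(2)[of "inv_into UNIV f _" "inv_into UNIV f _"] f(1)
    by (simp add: coset_equivalence_def bij_imp_bij_inv surj_f_inv_f bij_is_surj)
qed

lemma coset_equivalence_image:
  assumes "coset_equivalence G H f"
  shows "f ` zd_coset (G j) u = zd_coset (H j) (f u)"
proof (intro Set.set_eqI iffI)
  fix w assume w: "w \<in> zd_coset (H j) (f u)"
  have "f (inv_into UNIV f w) = w"
    using assms by (simp add: coset_equivalence_def surj_f_inv_f bij_is_surj)
  moreover have "f (inv_into UNIV f w) - f u \<in> H j \<longleftrightarrow> inv_into UNIV f w - u \<in> G j"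
    using assms unfolding coset_equivalence_def by blast
  ultimately show "w \<in> f ` zd_coset (G j) u"
    using w by (intro image_eqI[of _ _ "inv_into UNIV f w"]) (simp_all add: zd_coset_def)
qed (use assms in \<open>auto simp: zd_coset_def coset_equivalence_def\<close>)

lemma levelwise_in_odometer_set:
  assumes "odometer_sequence G" "odometer_sequence H" "coset_equivalence G H f"
    and "x \<in> odometer_set G"
  shows "levelwise f x \<in> odometer_set H"
proof -
  have "levelwise f x j \<in> range (zd_coset (H j))" for j
  proof -
    obtain u where "x j = zd_coset (G j) u"
      using assms(4) unfolding odometer_set_iff[OF assms(1)] by blast
    then show ?thesis by (simp add: levelwise_def coset_equivalence_image[OF assms(3)])
  qed
  moreover have "levelwise f x (Suc j) \<subseteq> levelwise f x j" for j
    using assms(1,4) by (simp add: levelwise_def odometer_set_iff image_mono)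
  ultimately show ?thesis using assms(2) by (simp add: odometer_set_iff)
qed

lemma continuous_map_levelwise:
  assumes "odometer_sequence G" "odometer_sequence H" "coset_equivalence G H f"
  shows "continuous_map (odometer_space G) (odometer_space H) (levelwise f)"
  unfolding odometer_space_def[of H]
proof (rule continuous_map_into_subtopology)
  show "levelwise f \<in> topspace (odometer_space G) \<rightarrow> odometer_set H"
    using levelwise_in_odometer_set[OF assms] by (auto simp: topspace_odometer_space)
  have "continuous_map (odometer_space G)
      (discrete_topology (carrier (zd_group Mod H j))) (\<lambda>x. f ` x j)" for j
  proof -
    have proj: "continuous_map (odometer_space G) (discrete_topology (carrier (zd_group Mod G j))) (\<lambda>x. x j)"
      unfolding odometer_space_def
      by (intro continuous_map_from_subtopology continuous_map_product_projection) simp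
    have "continuous_map (discrete_topology (carrier (zd_group Mod G j)))
        (discrete_topology (carrier (zd_group Mod H j))) (image f)"
      by (auto simp: carrier_zd_group_Mod coset_equivalence_image[OF assms(3)])
    from continuous_map_compose[OF proj this] show ?thesis by (simp add: o_def)
  qed
  then show "continuous_map (odometer_space G)
      (product_topology (\<lambda>j. discrete_topology (carrier (zd_group Mod H j))) UNIV) (levelwise f)"
    by (simp add: continuous_map_componentwise_UNIV levelwise_def)
qed

lemma homeomorphic_map_levelwise:
  assumes "odometer_sequence G" "odometer_sequence H" "coset_equivalence G H f"
  shows "homeomorphic_map (odometer_space G) (odometer_space H) (levelwise f)"
proof -
  have "homeomorphic_maps (odometer_space G) (odometer_space H) (levelwise f) (levelwise (inv_into UNIV f))"
    unfolding homeomorphic_maps_def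
    using continuous_map_levelwise[OF assms] assms(3)
      continuous_map_levelwise[OF assms(2,1) coset_equivalence_inv[OF assms(3)]]
    by (auto simp: levelwise_inv coset_equivalence_def)
  then show ?thesis by (rule homeomorphic_maps_imp_map)
qed

lemma coset_equivalence_translation: "coset_equivalence G G (\<lambda>u. u + v)"
proof -
  have "bij (\<lambda>u. u + v)"
    by (rule o_bij[of "\<lambda>u. u - v"]) auto
  then show ?thesis by (simp add: coset_equivalence_def)
qed

lemma odometer_shift_in_odometer_set:
  assumes "odometer_sequence G" "x \<in> odometer_set G"
  shows "odometer_shift G v x \<in> odometer_set G"
  using assms levelwise_in_odometer_set[OF assms(1,1) coset_equivalence_translation]
  by (simp add: odometer_shift_eq_levelwise)

lemma zd_action_odometer_shift:
  assumes "odometer_sequence G"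
  shows "zd_action (odometer_space G) (odometer_shift G)"
  unfolding zd_action_def
proof (intro conjI allI ballI)
  fix v
  show "homeomorphic_map (odometer_space G) (odometer_space G) (odometer_shift G v)"
    using homeomorphic_map_levelwise[OF assms assms coset_equivalence_translation[of _ v]]
    by (rule homeomorphic_map_eq)
      (simp add: odometer_shift_eq_levelwise assms topspace_odometer_space)
next
  fix v w x assume "x \<in> topspace (odometer_space G)"
  then show "odometer_shift G (v + w) x = odometer_shift G v (odometer_shift G w x)"
    using odometer_shift_in_odometer_set[OF assms, of x w]
    by (simp add: odometer_shift_eq_levelwise assms topspace_odometer_space levelwise_compose
        add.assoc add.commute[of w])
next
  fix x assume "x \<in> topspace (odometer_space G)"
  then show "odometer_shift G 0 x = x"
    by (simp add: odometer_shift_eq_levelwise assms topspace_odometer_space levelwise_def)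
qed

lemma is_odometer_shift:
  assumes "odometer_sequence G"
  shows "is_odometer (odometer_space G) (odometer_shift G)"
proof -
  have "homeomorphic_map (odometer_space G) (odometer_space G) (\<lambda>x. x)"
    by (simp add: homeomorphic_map_id[unfolded id_def])
  then show ?thesis
    using assms zd_action_odometer_shift[OF assms]
    unfolding is_odometer_def conjugate_actions_def by blast
qed

section \<open>Speedups from coset-preserving bijections\<close>

definition transported_shift ::
    "(nat \<Rightarrow> (int ^ 'e::finite) set) \<Rightarrow> (int ^ 'd::finite \<Rightarrow> int ^ 'e) \<Rightarrow> int ^ 'e
      \<Rightarrow> (nat \<Rightarrow> (int ^ 'd) set) \<Rightarrow> nat \<Rightarrow> (int ^ 'd) set"
  where "transported_shift H f v x = levelwise (inv_into UNIV f) (odometer_shift H v (levelwise f x))"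

context
  fixes G :: "nat \<Rightarrow> (int ^ 'd::finite) set" and H :: "nat \<Rightarrow> (int ^ 'e::finite) set"
    and f :: "int ^ 'd \<Rightarrow> int ^ 'e"
  assumes G: "odometer_sequence G" and H: "odometer_sequence H"
    and f: "coset_equivalence G H f"
begin

lemma bij_f: "bij f"
  using f by (simp add: coset_equivalence_def)

lemma transported_shift_eq_levelwise:
  assumes "x \<in> odometer_set G"
  shows "transported_shift H f v x = levelwise (\<lambda>u. inv_into UNIV f (f u + v)) x"
  by (simp add: transported_shift_def levelwise_compose
      odometer_shift_eq_levelwise[OF H levelwise_in_odometer_set[OF G H f assms]])

lemma levelwise_transported_shift:
  "levelwise f (transported_shift H f v x) = odometer_shift H v (levelwise f x)"
  by (simp add: transported_shift_def levelwise_inv bij_f)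

lemma zd_action_transported_shift:
  "zd_action (odometer_space G) (transported_shift H f)"
  unfolding zd_action_def
proof (intro conjI allI ballI)
  fix v
  have "homeomorphic_map (odometer_space H) (odometer_space H) (odometer_shift H v)"
    using zd_action_odometer_shift[OF H] by (simp add: zd_action_def)
  from homeomorphic_map_compose[OF homeomorphic_map_compose[OF homeomorphic_map_levelwise[OF G H f] this]
      homeomorphic_map_levelwise[OF H G coset_equivalence_inv[OF f]]]
  show "homeomorphic_map (odometer_space G) (odometer_space G) (transported_shift H f v)"
    by (simp add: transported_shift_def[abs_def] o_def)
next
  fix v w x assume x: "x \<in> topspace (odometer_space G)"
  then show "transported_shift H f (v + w) x = transported_shift H f v (transported_shift H f w x)"
    using zd_action_odometer_shift[OF H] levelwise_in_odometer_set[OF G H f, of x]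
    by (simp add: transported_shift_def levelwise_inv bij_f zd_action_def topspace_odometer_space)
next
  fix x assume x: "x \<in> topspace (odometer_space G)"
  then show "transported_shift H f 0 x = x"
    using zd_action_odometer_shift[OF H] levelwise_in_odometer_set[OF G H f, of x]
    by (simp add: transported_shift_def levelwise_inv bij_f zd_action_def topspace_odometer_space)
qed

lemma conjugate_transported_shift:
  "conjugate_actions (odometer_space G) (transported_shift H f) (odometer_space H) (odometer_shift H)"
  using homeomorphic_map_levelwise[OF G H f] levelwise_transported_shift
  unfolding conjugate_actions_def by blast

lemma is_odometer_transported_shift:
  "is_odometer (odometer_space G) (transported_shift H f)"
  using H zd_action_transported_shift conjugate_transported_shift
  unfolding is_odometer_def by blast

text \<open>A point \<open>x\<close> is a chain of cosets inside \<open>x 0\<close>. If the displacement \<open>u \<mapsto> inv f (f u + v) - u\<close>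
  is constant on \<open>x 0\<close>, then it translates every coset in the chain by the same vector, which means
  that the point is shifted by that vector. The cocycle identity is the telescoping of displacements
  along \<open>u\<close>, \<open>inv f (f u + v)\<close>, \<open>inv f (f u + v + w)\<close>.\<close>

lemma is_speedup_transported_shift:
  assumes level0: "\<And>u u' v. u - u' \<in> G 0 \<Longrightarrow> inv_into UNIV f (f u + v) - u = inv_into UNIV f (f u' + v) - u'"
  shows "is_speedup (odometer_space G) (odometer_shift G) (transported_shift H f)"
proof -
  define q where "q u v = inv_into UNIV f (f u + v) - u" for u v
  \<comment> \<open>the choice of a representative is immaterial, by \<open>level0\<close>\<close>
  define p where "p x v = q (SOME u. u \<in> x 0) v" for x :: "nat \<Rightarrow> (int ^ 'd) set" and v
  have q_cong: "q u v = q u' v" if "x \<in> odometer_set G" "u \<in> x 0" "u' \<in> x 0" for x u u' v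
    using odometer_set_coset[OF G that(1,3)] that(2) level0[of u u' v]
    by (auto simp: q_def zd_coset_def)
  have p_eq: "p x v = q u v" if "x \<in> odometer_set G" "u \<in> x 0" for x u v
    unfolding p_def using q_cong[OF that(1) someI[of "\<lambda>u. u \<in> x 0"] that(2)] that(2) by blast
  have speed: "transported_shift H f v x = odometer_shift G (p x v) x"
    if x: "x \<in> odometer_set G" for x v
  proof -
    have "inv_into UNIV f (f u + v) = u + p x v" if "u \<in> x j" for u j
      using p_eq[OF x, of u v] that odometer_set_mono[OF G x, of 0 j] by (auto simp: q_def)
    then show ?thesis
      by (auto simp: transported_shift_eq_levelwise odometer_shift_eq_levelwise G x levelwise_def
          intro!: ext image_cong)
  qed
  have "p x 0 = 0" "p x v + p (odometer_shift G (p x v) x) w = p x (v + w)"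
    if x: "x \<in> odometer_set G" for x v w
  proof -
    obtain u where u: "u \<in> x 0" using odometer_set_nonempty[OF G x] by blast
    show "p x 0 = 0"
      using p_eq[OF x u] bij_f by (simp add: q_def bij_is_inj)
    have "u + p x v \<in> odometer_shift G (p x v) x 0"
      using u by (auto simp: odometer_shift_eq_levelwise G x levelwise_def)
    from p_eq[OF odometer_shift_in_odometer_set[OF G x] this]
    show "p x v + p (odometer_shift G (p x v) x) w = p x (v + w)"
      using bij_f by (simp add: p_eq[OF x u] q_def bij_is_surj surj_f_inv_f add.assoc)
  qed
  then have "cocycle (odometer_space G) (odometer_shift G) p"
    by (simp add: cocycle_def topspace_odometer_space)
  then show ?thesis
    using speed zd_action_odometer_shift[OF G] zd_action_transported_shift
    by (auto simp: is_speedup_def topspace_odometer_space)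
qed

end

section \<open>A necessary condition for isomorphism\<close>

lemma isomorphic_conjugate_trans:
  assumes "isomorphic_actions X T Y S" "conjugate_actions Y S Z R"
  shows "isomorphic_actions X T Z R"
proof -
  obtain \<Phi> \<theta> where 1: "homeomorphic_map X Y \<Phi>" "\<theta> \<in> iso zd_group zd_group"
    "\<forall>v. \<forall>x\<in>topspace X. \<Phi> (T v x) = S (\<theta> v) (\<Phi> x)"
    using assms(1) by (auto simp: isomorphic_actions_def)
  obtain \<Psi> where 2: "homeomorphic_map Y Z \<Psi>" "\<forall>v. \<forall>y\<in>topspace Y. \<Psi> (S v y) = R v (\<Psi> y)"
    using assms(2) by (auto simp: conjugate_actions_def)
  have "\<Phi> x \<in> topspace Y" if "x \<in> topspace X" for x
    using homeomorphic_imp_surjective_map[OF 1(1)] that by blast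
  then show ?thesis
    unfolding isomorphic_actions_def
    using homeomorphic_map_compose[OF 1(1) 2(1)] 1(2,3) 2(2)
    by (intro exI[of _ "\<Psi> \<circ> \<Phi>"] exI[of _ \<theta>]) simp
qed

text \<open>A basic open set of the product constrains finitely many coordinates, and coordinate \<open>j\<close> of a
  point determines all earlier ones.\<close>

lemma odometer_neighbourhood:
  assumes G: "odometer_sequence G" and V: "openin (odometer_space G) V" "x \<in> V"
  obtains j where "\<And>y. y \<in> odometer_set G \<Longrightarrow> y j = x j \<Longrightarrow> y \<in> V"
proof -
  obtain W where W: "openin (product_topology (\<lambda>j. discrete_topology (carrier (zd_group Mod G j))) UNIV) W"
    "V = W \<inter> odometer_set G"
    using V(1) by (auto simp: odometer_space_def openin_subtopology)
  obtain U where fin: "finite {i. U i \<noteq> topspace (discrete_topology (carrier (zd_group Mod G i)))}"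
    and x: "x \<in> Pi\<^sub>E UNIV U" and UW: "Pi\<^sub>E UNIV U \<subseteq> W"
    using W V(2) unfolding openin_product_topology_alt by force
  obtain j where j: "\<And>i. U i \<noteq> carrier (zd_group Mod G i) \<Longrightarrow> i \<le> j"
    using fin by (auto simp: finite_nat_set_iff_bounded_le)
  show thesis
  proof (rule that)
    fix y assume y: "y \<in> odometer_set G" "y j = x j"
    have x': "x \<in> odometer_set G" using V(2) W(2) by blast
    have "y i \<in> U i" for i
    proof (cases "i \<le> j")
      case True
      obtain u where u: "u \<in> x j" using odometer_set_nonempty[OF G x'] by blast
      then have "u \<in> x i" "u \<in> y i"
        using y odometer_set_mono[OF G _ True] x' by auto
      then have "y i = x i"
        using odometer_set_coset[OF G] x' y(1) by metis
      then show ?thesis using x by auto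
    next
      case False
      then show ?thesis using j[of i] odometer_set_carrier[OF y(1), of i] by auto
    qed
    then show "y \<in> V" using UW W(2) y(1) by auto
  qed
qed

text \<open>Coordinate \<open>i\<close> of the isomorphism is locally constant, so near the point \<open>0\<close> it depends on some
  coordinate \<open>j\<close> only. A shift by \<open>v \<in> G j\<close> does not change coordinate \<open>j\<close> of \<open>0\<close>, so the shift by
  \<open>\<theta> v\<close> does not change coordinate \<open>i\<close> of the image, and \<open>\<theta> v \<in> H i\<close>.\<close>

lemma isomorphic_odometers_absorb:
  assumes G: "odometer_sequence G" and H: "odometer_sequence H"
    and iso: "isomorphic_actions (odometer_space G) (odometer_shift G) (odometer_space H) (odometer_shift H)"
  obtains \<theta> j where "\<theta> \<in> iso zd_group zd_group" "\<theta> ` G j \<subseteq> H i"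
proof -
  obtain \<Phi> \<theta> where \<Phi>: "homeomorphic_map (odometer_space G) (odometer_space H) \<Phi>"
    and \<theta>: "\<theta> \<in> iso zd_group zd_group"
    and eq: "\<And>v x. x \<in> odometer_set G \<Longrightarrow> \<Phi> (odometer_shift G v x) = odometer_shift H (\<theta> v) (\<Phi> x)"
    using iso unfolding isomorphic_actions_def topspace_odometer_space by blast
  \<comment> \<open>the point \<open>0\<close> of the inverse limit\<close>
  define x where "x j = zd_coset (G j) 0" for j
  have x: "x \<in> odometer_set G"
  proof -
    have "zd_coset (G (Suc j)) 0 \<subseteq> zd_coset (G j) 0" for j
      using odometer_sequenceD(2)[OF G, of j "Suc j"] by (auto simp: zd_coset_def)
    then show ?thesis unfolding odometer_set_iff[OF G] x_def by blast
  qed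
  have \<Phi>x: "\<Phi> x \<in> odometer_set H"
    using homeomorphic_imp_surjective_map[OF \<Phi>] x by (auto simp: topspace_odometer_space)
  define V where "V = {y \<in> topspace (odometer_space G). \<Phi> y i \<in> {\<Phi> x i}}"
  have "continuous_map (odometer_space H) (discrete_topology (carrier (zd_group Mod H i))) (\<lambda>y. y i)"
    unfolding odometer_space_def
    by (intro continuous_map_from_subtopology continuous_map_product_projection) simp
  from continuous_map_compose[OF homeomorphic_imp_continuous_map[OF \<Phi>] this]
  have "continuous_map (odometer_space G) (discrete_topology (carrier (zd_group Mod H i))) (\<lambda>y. \<Phi> y i)"
    by (simp add: o_def)
  moreover have "openin (discrete_topology (carrier (zd_group Mod H i))) {\<Phi> x i}"
    using odometer_set_carrier[OF \<Phi>x] by simp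
  ultimately have "openin (odometer_space G) V"
    unfolding V_def by (rule openin_continuous_map_preimage)
  moreover have "x \<in> V" using x by (simp add: V_def topspace_odometer_space)
  ultimately obtain j where j: "\<And>y. y \<in> odometer_set G \<Longrightarrow> y j = x j \<Longrightarrow> y \<in> V"
    using odometer_neighbourhood[OF G] by metis
  have "\<theta> v \<in> H i" if v: "v \<in> G j" for v
  proof -
    have "odometer_shift G v x j = zd_coset (G j) v"
      by (simp add: odometer_shift_eq_levelwise[OF G x] levelwise_def x_def
          zd_coset_translate[OF odometer_sequenceD(1)[OF G]])
    also have "\<dots> = x j"
      using v zd_coset_eqI[OF odometer_sequenceD(1)[OF G], of v j 0] by (simp add: x_def zd_coset_def)
    finally have "odometer_shift G v x \<in> V"
      using j odometer_shift_in_odometer_set[OF G x] by blast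
    then have same: "(\<lambda>u. u + \<theta> v) ` \<Phi> x i = \<Phi> x i"
      using eq[OF x] odometer_shift_eq_levelwise[OF H \<Phi>x] by (simp add: V_def levelwise_def)
    obtain u where u: "u \<in> \<Phi> x i" using odometer_set_nonempty[OF H \<Phi>x] by blast
    then have "u + \<theta> v \<in> zd_coset (H i) u"
      using same odometer_set_coset[OF H \<Phi>x u] by blast
    then show ?thesis by (simp add: zd_coset_def)
  qed
  then show thesis using that[OF \<theta>, of j] by blast
qed

section \<open>Rectangular sublattices of \<open>\<int>\<^sup>2\<close>\<close>

definition rect_lattice :: "int \<Rightarrow> int \<Rightarrow> (int ^ 2) set"
  where "rect_lattice m n = {u. m dvd u $ 1 \<and> n dvd u $ 2}"

lemma subgroup_rect_lattice: "subgroup (rect_lattice m n) zd_group"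
  by (auto simp: subgroup_zd_group_iff rect_lattice_def)

lemma finite_rcosets_rect_lattice:
  assumes "m > 0" "n > 0"
  shows "finite (rcosets\<^bsub>zd_group\<^esub> (rect_lattice m n))"
proof -
  have "zd_coset (rect_lattice m n) u \<in>
      (\<lambda>(a, b). zd_coset (rect_lattice m n) (vector [a, b])) ` ({0..<m} \<times> {0..<n})" for u
  proof (rule image_eqI[of _ _ "(u $ 1 mod m, u $ 2 mod n)"])
    show "zd_coset (rect_lattice m n) u =
        (\<lambda>(a, b). zd_coset (rect_lattice m n) (vector [a, b])) (u $ 1 mod m, u $ 2 mod n)"
      by (simp add: zd_coset_def rect_lattice_def mod_eq_dvd_iff[symmetric])
  qed (use assms in auto)
  then have "range (zd_coset (rect_lattice m n)) \<subseteq>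
      (\<lambda>(a, b). zd_coset (rect_lattice m n) (vector [a, b])) ` ({0..<m} \<times> {0..<n})"
    by blast
  then have "finite (range (zd_coset (rect_lattice m n)))"
    by (rule finite_subset) simp
  then show ?thesis
    by (simp add: carrier_zd_group_Mod[symmetric] FactGroup_def)
qed

lemma odometer_sequence_rect_lattice:
  assumes "a > 0" "b > 0"
  shows "odometer_sequence (\<lambda>j. rect_lattice (a * 3 ^ j) (b * 3 ^ j))"
  unfolding odometer_sequence_def
proof (intro conjI allI)
  fix j
  show "subgroup (rect_lattice (a * 3 ^ j) (b * 3 ^ j)) zd_group"
    by (rule subgroup_rect_lattice)
  show "finite (rcosets\<^bsub>zd_group\<^esub> (rect_lattice (a * 3 ^ j) (b * 3 ^ j)))"
    using assms by (intro finite_rcosets_rect_lattice) auto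
  have "c * 3 ^ j dvd c * 3 ^ Suc j" for c :: int by simp
  then show "rect_lattice (a * 3 ^ Suc j) (b * 3 ^ Suc j) \<subseteq> rect_lattice (a * 3 ^ j) (b * 3 ^ j)"
    unfolding rect_lattice_def by (blast intro: dvd_trans)
next
  \<comment> \<open>the inclusions are strict at every level\<close>
  have "vector [a * 3 ^ j, 0] \<in> rect_lattice (a * 3 ^ j) (b * 3 ^ j)"
    "vector [a * 3 ^ j, 0] \<notin> rect_lattice (a * 3 ^ Suc j) (b * 3 ^ Suc j)" for j
    using assms by (auto simp: rect_lattice_def)
  then have "rect_lattice (a * 3 ^ j) (b * 3 ^ j) \<noteq> rect_lattice (a * 3 ^ Suc j) (b * 3 ^ Suc j)" for j
    by metis
  then show "\<exists>\<^sub>\<infinity>j. rect_lattice (a * 3 ^ j) (b * 3 ^ j) \<noteq> rect_lattice (a * 3 ^ Suc j) (b * 3 ^ Suc j)"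
    by (simp add: INFM_nat)
qed

section \<open>Regrouping binary digits\<close>

text \<open>With \<open>u = (r + 2 a, s + 2 b)\<close> for bits \<open>r\<close> and \<open>s\<close>, the value is \<open>(r + 2 s + 4 a, b)\<close>: the
  representatives \<open>(r, s)\<close> of \<open>\<int>\<^sup>2\<close> modulo \<open>2\<int> \<times> 2\<int>\<close> become the representatives
  \<open>(r + 2 s, 0)\<close> modulo \<open>4\<int> \<times> \<int>\<close>, and \<open>(2 a, 2 b) \<mapsto> (4 a, b)\<close> is the isomorphism between
  these two subgroups.\<close>

definition regroup :: "int ^ 2 \<Rightarrow> int ^ 2"
  where "regroup u = vector [u $ 1 mod 2 + 2 * (u $ 2 mod 2 + 2 * (u $ 1 div 2)), u $ 2 div 2]"

definition ungroup :: "int ^ 2 \<Rightarrow> int ^ 2"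
  where "ungroup w = vector [w $ 1 mod 2 + 2 * (w $ 1 div 2 div 2), w $ 1 div 2 mod 2 + 2 * w $ 2]"

lemma lowest_bit:
  fixes a b :: int
  shows "(a mod 2 + 2 * b) mod 2 = a mod 2" and "(a mod 2 + 2 * b) div 2 = b"
  by presburger+

lemma ungroup_regroup: "ungroup (regroup u) = u"
  by (simp only: ungroup_def regroup_def vec_eq_iff forall_2 vector_2 lowest_bit mod_mult_div_eq)

lemma regroup_ungroup: "regroup (ungroup w) = w"
  by (simp only: ungroup_def regroup_def vec_eq_iff forall_2 vector_2 lowest_bit mod_mult_div_eq)

lemma bij_regroup: "bij regroup"
  by (rule o_bij[of ungroup]) (auto simp: ungroup_regroup regroup_ungroup)

lemma inv_regroup: "inv_into UNIV regroup = ungroup"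
  by (rule inv_unique_comp) (auto simp: ungroup_regroup regroup_ungroup)

lemma regroup_translate:
  "regroup (u + vector [2 * a, 2 * b]) = regroup u + vector [4 * a, b]"
  by (simp add: regroup_def vec_eq_iff forall_2)

lemma ungroup_translate:
  "ungroup (w + vector [4 * a, b]) = ungroup w + vector [2 * a, 2 * b]"
proof -
  have "(x + 4 * a) mod 2 = x mod 2" "(x + 4 * a) div 2 = x div 2 + 2 * a" for x :: int
    by presburger+
  then show ?thesis by (simp add: ungroup_def vec_eq_iff forall_2)
qed

lemma rect_latticeE:
  assumes "u - w \<in> rect_lattice (m * k) (n * k)"
  obtains a b where "u = w + vector [m * a, n * b]" "k dvd a" "k dvd b"
proof -
  obtain r s where "u $ 1 - w $ 1 = m * k * r" "u $ 2 - w $ 2 = n * k * s"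
    using assms by (auto simp: rect_lattice_def dvd_def)
  then have "u = w + vector [m * (k * r), n * (k * s)]"
    by (simp add: vec_eq_iff forall_2 algebra_simps)
  then show thesis using that[of "k * r" "k * s"] by simp
qed

section \<open>The two odometers\<close>

abbreviation square_lattices :: "nat \<Rightarrow> (int ^ 2) set"
  where "square_lattices j \<equiv> rect_lattice (2 * 3 ^ j) (2 * 3 ^ j)"

abbreviation oblong_lattices :: "nat \<Rightarrow> (int ^ 2) set"
  where "oblong_lattices j \<equiv> rect_lattice (4 * 3 ^ j) (1 * 3 ^ j)"

lemma odometer_sequence_lattices:
  "odometer_sequence square_lattices" "odometer_sequence oblong_lattices"
  by (rule odometer_sequence_rect_lattice; simp)+

text \<open>The isomorphism \<open>(2 a, 2 b) \<mapsto> (4 a, b)\<close> carries the square lattice of level \<open>j\<close> onto the oblong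
  one, as membership means in both cases that \<open>3^j\<close> divides \<open>a\<close> and \<open>b\<close>.\<close>

lemma coset_equivalence_regroup: "coset_equivalence square_lattices oblong_lattices regroup"
  unfolding coset_equivalence_def
proof (intro conjI allI iffI bij_regroup)
  fix j u w
  assume "u - w \<in> square_lattices j"
  then obtain a b where "u = w + vector [2 * a, 2 * b]" "3 ^ j dvd a" "3 ^ j dvd b"
    by (rule rect_latticeE)
  then show "regroup u - regroup w \<in> oblong_lattices j"
    by (simp add: regroup_translate rect_lattice_def)
next
  fix j u w
  assume "regroup u - regroup w \<in> oblong_lattices j"
  then obtain a b where "regroup u = regroup w + vector [4 * a, 1 * b]" and dvd: "3 ^ j dvd a" "3 ^ j dvd b"
    by (rule rect_latticeE)
  then have "ungroup (regroup u) = ungroup (regroup w) + vector [2 * a, 2 * b]"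
    by (simp add: ungroup_translate)
  then show "u - w \<in> square_lattices j"
    using dvd by (simp add: ungroup_regroup rect_lattice_def)
qed

lemma regroup_displacement_cong:
  assumes "u - u' \<in> square_lattices 0"
  shows "inv_into UNIV regroup (regroup u + v) - u = inv_into UNIV regroup (regroup u' + v) - u'"
proof -
  obtain a b where "u = u' + vector [2 * a, 2 * b]"
    using rect_latticeE[OF assms] by blast
  then have "inv_into UNIV regroup (regroup u + v) = ungroup ((regroup u' + v) + vector [4 * a, b])"
    by (simp add: inv_regroup regroup_translate add_ac)
  then show ?thesis
    using \<open>u = _\<close> by (simp add: ungroup_translate inv_regroup)
qed

lemma zd_iso_scale:
  fixes \<theta> :: "int ^ 'd::finite \<Rightarrow> int ^ 'd"
  assumes "\<theta> \<in> iso zd_group zd_group"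
  shows "\<theta> (of_nat n * w) = of_nat n * \<theta> w"
proof -
  have add: "\<theta> (u + w) = \<theta> u + \<theta> w" for u w
    using assms by (auto simp: iso_def hom_def zd_group_def)
  have zero: "\<theta> 0 = 0" using add[of 0 0] by simp
  show ?thesis by (induction n) (simp_all add: add zero distrib_right)
qed

text \<open>The vector \<open>(1, 0)\<close> has order 4 modulo \<open>4\<int> \<times> \<int>\<close>, while every vector has order dividing
  \<open>2 \<sqdot> 3^j\<close> modulo the square lattice of level \<open>j\<close>.\<close>

lemma not_isomorphic_square_oblong:
  "\<not> isomorphic_actions (odometer_space square_lattices) (odometer_shift square_lattices)
      (odometer_space oblong_lattices) (odometer_shift oblong_lattices)"
proof
  assume iso: "isomorphic_actions (odometer_space square_lattices) (odometer_shift square_lattices)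
      (odometer_space oblong_lattices) (odometer_shift oblong_lattices)"
  obtain \<theta> j where \<theta>: "\<theta> \<in> iso zd_group zd_group"
    and sub: "\<theta> ` square_lattices j \<subseteq> oblong_lattices 0"
    by (rule isomorphic_odometers_absorb[OF odometer_sequence_lattices iso, where i = 0])
  have "surj \<theta>"
    using \<theta> by (auto simp: iso_def zd_group_def bij_betw_def)
  then obtain w where w: "\<theta> w = vector [1, 0]" by (metis surjD)
  define n :: nat where "n = 2 * 3 ^ j"
  have int_n: "int n = 2 * 3 ^ j" by (simp add: n_def)
  have "of_nat n * w \<in> square_lattices j"
    by (simp add: rect_lattice_def of_nat_index int_n)
  with sub have "\<theta> (of_nat n * w) \<in> oblong_lattices 0" by blast
  then have "4 dvd int n"
    unfolding zd_iso_scale[OF \<theta>] w by (simp add: rect_lattice_def of_nat_index)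
  then have "(2 * 2 :: int) dvd 2 * 3 ^ j" by (simp add: int_n)
  then have "even (3 ^ j :: int)"
    by (subst (asm) dvd_times_left_cancel_iff) simp_all
  then show False by simp
qed

theorem theorem5p5:
  shows "\<exists>(X :: (nat \<Rightarrow> (int ^ 2) set) topology)
      (T :: int ^ 2 \<Rightarrow> (nat \<Rightarrow> (int ^ 2) set) \<Rightarrow> (nat \<Rightarrow> (int ^ 2) set))
      (S :: int ^ 2 \<Rightarrow> (nat \<Rightarrow> (int ^ 2) set) \<Rightarrow> (nat \<Rightarrow> (int ^ 2) set)).
    is_odometer X T \<and> is_odometer X S \<and>
    \<not> isomorphic_actions X T X S \<and>
    is_speedup X T S"
proof -
  let ?S = "transported_shift oblong_lattices regroup"
  note GHf = odometer_sequence_lattices coset_equivalence_regroup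
  have "\<not> isomorphic_actions (odometer_space square_lattices) (odometer_shift square_lattices)
      (odometer_space square_lattices) ?S"
    using isomorphic_conjugate_trans conjugate_transported_shift[OF GHf] not_isomorphic_square_oblong
    by blast
  then show ?thesis
    using is_odometer_shift[OF odometer_sequence_lattices(1)] is_odometer_transported_shift[OF GHf]
      is_speedup_transported_shift[OF GHf regroup_displacement_cong]
    by blast
qed

end
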